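(* Let $C_{abcd}$ be a Weyl tensor at a point of a spacetime with metric $g_{ab}$ of signature $(+,-,-,-)$, let $T_{abcd}$ be its Bel–Robinson tensor, and let $I=\Psi_{ABCD}\Psi^{ABCD}$ where $\Psi_{ABCD}$ is the Weyl spinor. For a unit timelike vector $t^a$ (i.e. $g_{ab}t^at^b=1$) put $P_1(t^a)=T_{abcd}t^at^bt^ct^d$. Then $4P_1(t^a)\geq |I|$ for every unit timelike vector $t^a$. Moreover, $4P_1(t^a)=|I|$ if and only if there exists $\theta\in\mathbb R$ such that ${}^{(\theta)}C_{abcd}t^bt^c=0$, where ${}^{(\theta)}C_{abcd}=\cos(\theta)\,C_{abcd}+\sin(\theta)\,{}^{*}C_{abcd}$.
   Context: ${}^{*}C_{abcd}$ denotes the (Hodge) dual of the Weyl tensor. The Weyl spinor $\Psi_{ABCD}$ is the totally symmetric spinor with $C_{abcd}=\Psi_{ABCD}\epsilon_{A'B'}\epsilon_{C'D'}+\bar\Psi_{A'B'C'D'}\epsilon_{AB}\epsilon_{CD}$, and the Bel–Robinson tensor is $T_{abcd}=\Psi_{ABCD}\bar\Psi_{A'B'C'D'}$ (Penrose–Rindler conventions). *)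

theory Defs
  imports Complex_Main
begin

text \<open>Everything is expressed at a single point of spacetime, in components with respect to
an orthonormal tetrad (vector indices a = 0,1,2,3, with a = 0 timelike) and a normalized spin
frame (spinor indices A = 0,1).  Indices are natural numbers; only values below 4 (tensor
indices) resp. below 2 (spinor indices) are ever used.\<close>

definition eta :: "nat \<Rightarrow> real" where
  "eta a = (if a = 0 then 1 else -1)"

text \<open>Spinor epsilon: eps_01 = 1 = eps^01 (Penrose--Rindler).\<close>
definition eps :: "nat \<Rightarrow> nat \<Rightarrow> complex" where
  "eps A B = (if A = 0 \<and> B = 1 then 1 else if A = 1 \<and> B = 0 then -1 else 0)"

text \<open>Soldering form (Infeld--van der Waerden symbols, Penrose--Rindler (3.1.49)):
  V^{AA'} = sum_a V^a sol a A A', i.e.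
  V^{AA'} = 1/sqrt 2 [[V^0+V^3, V^1+iV^2],[V^1-iV^2, V^0-V^3]].
  Consequently V_a = sum_{AA'} V_{AA'} sol a A A' and g_ab = eps_AB eps_A'B'.\<close>
definition sol :: "nat \<Rightarrow> nat \<Rightarrow> nat \<Rightarrow> complex" where
  "sol a A B = complex_of_real (1 / sqrt 2) *
     (if a = 0 then (if A = B \<and> A < 2 then 1 else 0)
      else if a = 1 then (if (A = 0 \<and> B = 1) \<or> (A = 1 \<and> B = 0) then 1 else 0)
      else if a = 2 then (if A = 0 \<and> B = 1 then \<i> else if A = 1 \<and> B = 0 then - \<i> else 0)
      else if a = 3 then (if A = 0 \<and> B = 0 then 1 else if A = 1 \<and> B = 1 then -1 else 0)
      else 0)"

definition totally_symmetric :: "(nat \<Rightarrow> nat \<Rightarrow> nat \<Rightarrow> nat \<Rightarrow> complex) \<Rightarrow> bool" where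
  "totally_symmetric Psi \<longleftrightarrow>
     (\<forall>A B C D. A < 2 \<longrightarrow> B < 2 \<longrightarrow> C < 2 \<longrightarrow> D < 2 \<longrightarrow>
        Psi A B C D = Psi B A C D \<and> Psi A B C D = Psi A C B D \<and> Psi A B C D = Psi A B D C)"

definition weyl_spinor_form ::
  "(nat \<Rightarrow> nat \<Rightarrow> nat \<Rightarrow> nat \<Rightarrow> complex) \<Rightarrow>
   nat \<Rightarrow> nat \<Rightarrow> nat \<Rightarrow> nat \<Rightarrow> nat \<Rightarrow> nat \<Rightarrow> nat \<Rightarrow> nat \<Rightarrow> complex" where
  "weyl_spinor_form Psi A A' B B' C C' D D' =
     Psi A B C D * eps A' B' * eps C' D' + cnj (Psi A' B' C' D') * eps A B * eps C D"

text \<open>Tensor components C_abcd (all indices down) of the Weyl tensor with Weyl spinor Psi.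
  The complex sum is real (the soldering form is Hermitian); we take its real part.\<close>
definition weyl_of_spinor ::
  "(nat \<Rightarrow> nat \<Rightarrow> nat \<Rightarrow> nat \<Rightarrow> complex) \<Rightarrow> nat \<Rightarrow> nat \<Rightarrow> nat \<Rightarrow> nat \<Rightarrow> real" where
  "weyl_of_spinor Psi a b c d = Re
     (\<Sum>A<2. \<Sum>A'<2. \<Sum>B<2. \<Sum>B'<2. \<Sum>C<2. \<Sum>C'<2. \<Sum>D<2. \<Sum>D'<2.
        weyl_spinor_form Psi A A' B B' C C' D D' *
        sol a A A' * sol b B B' * sol c C C' * sol d D D')"

text \<open>Bel--Robinson tensor T_abcd = Psi_ABCD conj(Psi)_A'B'C'D' (all indices down); real.\<close>
definition bel_robinson ::
  "(nat \<Rightarrow> nat \<Rightarrow> nat \<Rightarrow> nat \<Rightarrow> complex) \<Rightarrow> nat \<Rightarrow> nat \<Rightarrow> nat \<Rightarrow> nat \<Rightarrow> real" where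
  "bel_robinson Psi a b c d = Re
     (\<Sum>A<2. \<Sum>A'<2. \<Sum>B<2. \<Sum>B'<2. \<Sum>C<2. \<Sum>C'<2. \<Sum>D<2. \<Sum>D'<2.
        Psi A B C D * cnj (Psi A' B' C' D') *
        sol a A A' * sol b B B' * sol c C C' * sol d D D')"

definition P1 :: "(nat \<Rightarrow> nat \<Rightarrow> nat \<Rightarrow> nat \<Rightarrow> complex) \<Rightarrow> (nat \<Rightarrow> real) \<Rightarrow> real" where
  "P1 Psi t = (\<Sum>a<4. \<Sum>b<4. \<Sum>c<4. \<Sum>d<4. bel_robinson Psi a b c d * t a * t b * t c * t d)"

definition invariant_I :: "(nat \<Rightarrow> nat \<Rightarrow> nat \<Rightarrow> nat \<Rightarrow> complex) \<Rightarrow> complex" where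
  "invariant_I Psi =
     (\<Sum>A<2. \<Sum>B<2. \<Sum>C<2. \<Sum>D<2. \<Sum>E<2. \<Sum>F<2. \<Sum>G<2. \<Sum>H<2.
        Psi A B C D * eps A E * eps B F * eps C G * eps D H * Psi E F G H)"

text \<open>Levi-Civita symbol e_abcd with e_0123 = 1 (volume form in an orthonormal frame).\<close>
definition levi :: "nat \<Rightarrow> nat \<Rightarrow> nat \<Rightarrow> nat \<Rightarrow> real" where
  "levi a b c d =
     (if a < 4 \<and> b < 4 \<and> c < 4 \<and> d < 4 then
        real_of_int ((int b - int a) * (int c - int a) * (int d - int a) *
                     (int c - int b) * (int d - int b) * (int d - int c)) / 12
      else 0)"

definition hodge ::
  "(nat \<Rightarrow> nat \<Rightarrow> nat \<Rightarrow> nat \<Rightarrow> real) \<Rightarrow> nat \<Rightarrow> nat \<Rightarrow> nat \<Rightarrow> nat \<Rightarrow> real" where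
  "hodge Cw a b c d = (1/2) * (\<Sum>e<4. \<Sum>f<4. levi a b e f * eta e * eta f * Cw e f c d)"

definition duality_rotation ::
  "real \<Rightarrow> (nat \<Rightarrow> nat \<Rightarrow> nat \<Rightarrow> nat \<Rightarrow> real) \<Rightarrow> nat \<Rightarrow> nat \<Rightarrow> nat \<Rightarrow> nat \<Rightarrow> real" where
  "duality_rotation \<theta> Cw a b c d = cos \<theta> * Cw a b c d + sin \<theta> * hodge Cw a b c d"

end

theory Submission
  imports Defs
begin

text \<open>
  The spinor matrix of a unit timelike vector is Hermitian with determinant 1/2, hence definite, and
  its Cholesky factorisation has the form \<open>\<plusminus> L L\<^sup>\<dagger> / \<surd>2\<close> with \<open>L\<close> in SL(2,C).  In the spin frame given by
  \<open>L\<close> the Weyl spinor has five components \<open>f\<^sub>0, \<dots>, f\<^sub>4\<close>, the invariant keeps its shape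
  \<open>I = 2 f\<^sub>0 f\<^sub>4 - 8 f\<^sub>1 f\<^sub>3 + 6 f\<^sub>2\<^sup>2\<close>, and
  \<open>4 P\<^sub>1 = |f\<^sub>0|\<^sup>2 + 4 |f\<^sub>1|\<^sup>2 + 6 |f\<^sub>2|\<^sup>2 + 4 |f\<^sub>3|\<^sup>2 + |f\<^sub>4|\<^sup>2\<close>.
  For every phase \<open>v\<close>, with \<open>g\<^sub>i = v f\<^sub>i\<close> and a bar for complex conjugation,
  \<open>4 P\<^sub>1 + Re (v\<^sup>2 I) = |g\<^sub>0 + bar g\<^sub>4|\<^sup>2 + 4 |g\<^sub>1 - bar g\<^sub>3|\<^sup>2 + 3 |g\<^sub>2 + bar g\<^sub>2|\<^sup>2\<close>.
  Choosing \<open>v\<^sup>2 I = - |I|\<close> gives the inequality, with equality iff the three squares vanish for some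
  phase.  A duality rotation multiplies the Weyl spinor by a phase, and the vanishing of the three
  squares says exactly that the electric part of the rotated Weyl tensor is zero.
\<close>

section \<open>Finite index sums and their reorderings\<close>

lemma sum_lessThan_2: "(\<Sum>i<2. f i) = f 0 + f (1::nat)"
  by (simp add: eval_nat_numeral)

lemma sum_lessThan_4: "(\<Sum>i<4. f i) = f 0 + f 1 + f 2 + f (3::nat)"
  by (simp add: eval_nat_numeral)

lemma cnj_sol: "cnj (sol a A B) = sol a B A"
  by (auto simp: sol_def)

lemma cnj_eps: "cnj (eps A B) = eps A B"
  by (auto simp: eps_def)

text \<open>With two values per index the sum has 256 explicit terms, so reordering is normalisation
  modulo associativity and commutativity. The target order separates unprimed from primed
  indices.\<close>

lemma sum_deinterleave:
  fixes f :: "nat \<Rightarrow> nat \<Rightarrow> nat \<Rightarrow> nat \<Rightarrow> nat \<Rightarrow> nat \<Rightarrow> nat \<Rightarrow> nat \<Rightarrow> complex"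
  shows "(\<Sum>A<2. \<Sum>A'<2. \<Sum>B<2. \<Sum>B'<2. \<Sum>C<2. \<Sum>C'<2. \<Sum>D<2. \<Sum>D'<2. f A A' B B' C C' D D')
       = (\<Sum>A<2. \<Sum>B<2. \<Sum>C<2. \<Sum>D<2. \<Sum>A'<2. \<Sum>B'<2. \<Sum>C'<2. \<Sum>D'<2. f A A' B B' C C' D D')"
  by (simp only: sum_lessThan_2 ac_simps)

lemma sum_deinterleave_outer_first:
  fixes f :: "nat \<Rightarrow> nat \<Rightarrow> nat \<Rightarrow> nat \<Rightarrow> nat \<Rightarrow> nat \<Rightarrow> nat \<Rightarrow> nat \<Rightarrow> complex"
  shows "(\<Sum>A<2. \<Sum>A'<2. \<Sum>D<2. \<Sum>D'<2. \<Sum>B<2. \<Sum>B'<2. \<Sum>C<2. \<Sum>C'<2. f A A' B B' C C' D D')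
       = (\<Sum>A<2. \<Sum>B<2. \<Sum>C<2. \<Sum>D<2. \<Sum>A'<2. \<Sum>B'<2. \<Sum>C'<2. \<Sum>D'<2. f A A' B B' C C' D D')"
  by (simp only: sum_lessThan_2 ac_simps)

text \<open>Serves complex conjugation, which exchanges primed and unprimed indices.\<close>

lemma sum_swap_pairs:
  fixes f :: "nat \<Rightarrow> nat \<Rightarrow> nat \<Rightarrow> nat \<Rightarrow> nat \<Rightarrow> nat \<Rightarrow> nat \<Rightarrow> nat \<Rightarrow> complex"
  shows "(\<Sum>A<2. \<Sum>A'<2. \<Sum>B<2. \<Sum>B'<2. \<Sum>C<2. \<Sum>C'<2. \<Sum>D<2. \<Sum>D'<2. f A A' B B' C C' D D')
       = (\<Sum>A<2. \<Sum>A'<2. \<Sum>B<2. \<Sum>B'<2. \<Sum>C<2. \<Sum>C'<2. \<Sum>D<2. \<Sum>D'<2. f A' A B' B C' C D' D)"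
  by (simp only: sum_lessThan_2 ac_simps)

section \<open>Anti-self-dual half of the Weyl tensor and the Hodge dual\<close>

text \<open>The anti-self-dual half of the Weyl tensor: the Hodge dual acts on it as multiplication by \<open>-\<i>\<close>.\<close>
definition weyl_asd ::
  "(nat \<Rightarrow> nat \<Rightarrow> nat \<Rightarrow> nat \<Rightarrow> complex) \<Rightarrow> nat \<Rightarrow> nat \<Rightarrow> nat \<Rightarrow> nat \<Rightarrow> complex" where
  "weyl_asd Psi a b c d =
     (\<Sum>A<2. \<Sum>A'<2. \<Sum>B<2. \<Sum>B'<2. \<Sum>C<2. \<Sum>C'<2. \<Sum>D<2. \<Sum>D'<2.
        Psi A B C D * eps A' B' * eps C' D' *
        sol a A A' * sol b B B' * sol c C C' * sol d D D')"

text \<open>\<open>sol\<close> is Hermitian and \<open>eps\<close> is real, so the two summands of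
  \<open>weyl_spinor_form\<close> contribute complex conjugate sums.\<close>

lemma weyl_of_spinor_eq: "weyl_of_spinor Psi a b c d = 2 * Re (weyl_asd Psi a b c d)"
proof -
  have "(\<Sum>A<2. \<Sum>A'<2. \<Sum>B<2. \<Sum>B'<2. \<Sum>C<2. \<Sum>C'<2. \<Sum>D<2. \<Sum>D'<2.
          cnj (Psi A' B' C' D') * eps A B * eps C D *
          sol a A A' * sol b B B' * sol c C C' * sol d D D') = cnj (weyl_asd Psi a b c d)"
    unfolding weyl_asd_def cnj_sum complex_cnj_mult cnj_sol cnj_eps
    by (subst sum_swap_pairs) (rule refl)
  then show ?thesis
    unfolding weyl_of_spinor_def weyl_spinor_form_def distrib_right sum.distrib
      weyl_asd_def[symmetric] by simp
qed

text \<open>A check of sixteen index pairs. Symmetry of \<open>\<phi>\<close> excludes an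
  \<open>eps\<close> part, which would add to \<open>z\<close> a multiple of the metric, annihilated
  by \<open>levi\<close>. The factor 2 cancels against the \<open>1/2\<close> in
  \<open>hodge\<close>.\<close>

lemma hodge_asd_bivector:
  assumes sym: "\<phi> 0 1 = \<phi> 1 (0::nat)" and "a < 4" "b < 4"
    and z: "\<And>a b. z a b = (\<Sum>A<2. \<Sum>A'<2. \<Sum>B<2. \<Sum>B'<2. \<phi> A B * eps A' B' * sol a A A' * sol b B B')"
  shows "(\<Sum>e<4. \<Sum>f<4. complex_of_real (levi a b e f * eta e * eta f) * z e f) = - 2 * \<i> * z a b"
proof -
  have r: "complex_of_real (sqrt 2) * complex_of_real (sqrt 2) = 2"
    by (metis of_real_mult of_real_numeral real_sqrt_mult_self abs_numeral)
  have "a = 0 \<or> a = 1 \<or> a = 2 \<or> a = 3" "b = 0 \<or> b = 1 \<or> b = 2 \<or> b = 3"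
    using assms by auto
  then show ?thesis
    by (elim disjE; simp add: z sum_lessThan_2 sum_lessThan_4 levi_def eta_def sol_def eps_def sym[simplified] field_simps r)
qed

lemma hodge_weyl:
  assumes sym: "totally_symmetric Psi" and "a < 4" "b < 4" "c < 4" "d < 4"
    and Cw: "\<And>a b c d. \<lbrakk>a < 4; b < 4; c < 4; d < 4\<rbrakk> \<Longrightarrow> Cw a b c d = weyl_of_spinor Psi a b c d"
  shows "hodge Cw a b c d = 2 * Re (- \<i> * weyl_asd Psi a b c d)"
proof -
  \<comment> \<open>\<open>hodge\<close> acts on the first index pair only: \<open>c\<close> and
    \<open>d\<close> stay fixed, and the second pair is absorbed into \<open>\<phi>\<close>, which
    inherits its symmetry from \<open>Psi\<close>.\<close>
  define \<phi> where "\<phi> A B = (\<Sum>C<2. \<Sum>C'<2. \<Sum>D<2. \<Sum>D'<2.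
      Psi A B C D * eps C' D' * sol c C C' * sol d D D')" for A B
  have z: "weyl_asd Psi a b c d = (\<Sum>A<2. \<Sum>A'<2. \<Sum>B<2. \<Sum>B'<2. \<phi> A B * eps A' B' * sol a A A' * sol b B B')"
    for a b
    unfolding weyl_asd_def \<phi>_def sum_distrib_right
    by (intro sum.cong refl) (simp only: mult_ac)
  have sym': "\<phi> 0 1 = \<phi> 1 0"
    unfolding \<phi>_def using sym
    by (intro sum.cong refl) (simp add: totally_symmetric_def)
  have "hodge Cw a b c d = (\<Sum>e<4. \<Sum>f<4. Re (complex_of_real (levi a b e f * eta e * eta f) * weyl_asd Psi e f c d))"
    unfolding hodge_def sum_distrib_left
    using assms by (intro sum.cong refl) (simp add: weyl_of_spinor_eq)
  also have "\<dots> = Re (- 2 * \<i> * weyl_asd Psi a b c d)"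
    using hodge_asd_bivector[OF sym' assms(2,3), of "\<lambda>a b. weyl_asd Psi a b c d", OF z]
    by (simp only: Re_sum[symmetric])
  finally show ?thesis by simp
qed

section \<open>Contraction with the timelike vector\<close>

definition vec_spinor :: "(nat \<Rightarrow> real) \<Rightarrow> nat \<Rightarrow> nat \<Rightarrow> complex" where
  "vec_spinor t A A' = (\<Sum>a<4. sol a A A' * complex_of_real (t a))"

lemma sum_contract: "(\<Sum>a<4. (\<Sum>A<2. F a A) * g a) = (\<Sum>A<2. \<Sum>a<4. F a A * (g (a::nat) :: complex))"
  for F :: "nat \<Rightarrow> nat \<Rightarrow> complex"
  unfolding sum_distrib_right by (rule sum.swap)

text \<open>Four versions, because the soldering form of the contracted index may be followed by
  zero to three further factors.\<close>

lemma sum_contract_sol: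
  "(\<Sum>a<4. x * sol a A A' * complex_of_real (t a)) = x * vec_spinor t A A'"
  "(\<Sum>a<4. x * sol a A A' * y * complex_of_real (t a)) = x * vec_spinor t A A' * y"
  "(\<Sum>a<4. x * sol a A A' * y * z * complex_of_real (t a)) = x * vec_spinor t A A' * y * z"
  "(\<Sum>a<4. x * sol a A A' * y * z * w * complex_of_real (t a)) = x * vec_spinor t A A' * y * z * w"
  by (simp_all only: vec_spinor_def sum_distrib_left sum_distrib_right mult_ac)

text \<open>Spinor form of the electric part of \<open>weyl_asd\<close>: the second and third tensor
  indices are contracted with the vector.\<close>

definition electric_spinor :: "(nat \<Rightarrow> nat \<Rightarrow> nat \<Rightarrow> nat \<Rightarrow> complex) \<Rightarrow> (nat \<Rightarrow> nat \<Rightarrow> complex) \<Rightarrow> nat \<Rightarrow> nat \<Rightarrow> nat \<Rightarrow> nat \<Rightarrow> complex"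
  where "electric_spinor Psi T A A' D D' =
     (\<Sum>B<2. \<Sum>B'<2. \<Sum>C<2. \<Sum>C'<2. Psi A B C D * eps A' B' * eps C' D' * T B B' * T C C')"

lemma weyl_asd_contract:
  "(\<Sum>b<4. \<Sum>c<4. weyl_asd Psi a b c d * complex_of_real (t b) * complex_of_real (t c))
   = (\<Sum>A<2. \<Sum>A'<2. \<Sum>D<2. \<Sum>D'<2. electric_spinor Psi (vec_spinor t) A A' D D' * sol a A A' * sol d D D')"
proof -
  have "(\<Sum>b<4. \<Sum>c<4. weyl_asd Psi a b c d * complex_of_real (t b) * complex_of_real (t c))
      = (\<Sum>b<4. (\<Sum>c<4. weyl_asd Psi a b c d * complex_of_real (t c)) * complex_of_real (t b))"
    by (simp only: sum_distrib_left sum_distrib_right mult_ac)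
  also have "\<dots> = (\<Sum>A<2. \<Sum>A'<2. \<Sum>B<2. \<Sum>B'<2. \<Sum>C<2. \<Sum>C'<2. \<Sum>D<2. \<Sum>D'<2.
        Psi A B C D * eps A' B' * eps C' D' *
        sol a A A' * vec_spinor t B B' * vec_spinor t C C' * sol d D D')"
    unfolding weyl_asd_def by (simp only: sum_contract sum_contract_sol)
  also have "\<dots> = (\<Sum>A<2. \<Sum>A'<2. \<Sum>D<2. \<Sum>D'<2. electric_spinor Psi (vec_spinor t) A A' D D' * sol a A A' * sol d D D')"
    unfolding electric_spinor_def sum_distrib_right
    by (subst sum_deinterleave, subst sum_deinterleave_outer_first) (simp only: mult_ac)
  finally show ?thesis .
qed

text \<open>The dual multiplies the anti-self-dual half by \<open>-\<i>\<close>, and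
  \<open>cos \<theta> - \<i> * sin \<theta> = cis (- \<theta>)\<close>.\<close>

lemma rotated_electric:
  assumes sym: "totally_symmetric Psi" and "a < 4" "d < 4"
    and Cw: "\<And>a b c d. \<lbrakk>a < 4; b < 4; c < 4; d < 4\<rbrakk> \<Longrightarrow> Cw a b c d = weyl_of_spinor Psi a b c d"
  shows "(\<Sum>b<4. \<Sum>c<4. duality_rotation \<theta> Cw a b c d * t b * t c)
    = 2 * Re (cis (- \<theta>) * (\<Sum>A<2. \<Sum>A'<2. \<Sum>D<2. \<Sum>D'<2.
        electric_spinor Psi (vec_spinor t) A A' D D' * sol a A A' * sol d D D'))"
proof -
  have "duality_rotation \<theta> Cw a b c d * t b * t c =
    2 * Re (cis (- \<theta>) * (weyl_asd Psi a b c d * complex_of_real (t b) * complex_of_real (t c)))"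
    if "b < 4" "c < 4" for b c
    using that assms unfolding duality_rotation_def
    by (simp add: hodge_weyl weyl_of_spinor_eq algebra_simps)
  then have "(\<Sum>b<4. \<Sum>c<4. duality_rotation \<theta> Cw a b c d * t b * t c) =
    (\<Sum>b<4. \<Sum>c<4. 2 * Re (cis (- \<theta>) * (weyl_asd Psi a b c d * complex_of_real (t b) * complex_of_real (t c))))"
    by simp
  also have "\<dots> = 2 * Re (cis (- \<theta>) * (\<Sum>b<4. \<Sum>c<4. weyl_asd Psi a b c d * complex_of_real (t b) * complex_of_real (t c)))"
    by (simp only: sum_distrib_left Re_sum)
  finally show ?thesis unfolding weyl_asd_contract .
qed

section \<open>Pairings of spinors under a change of spin frame\<close>

text \<open>Common shape of both scalars: \<open>K = eps\<close> with \<open>Y = X\<close> gives the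
  invariant \<open>I\<close>, while \<open>K = vec_spinor t\<close> with \<open>Y\<close> conjugate
  to \<open>X\<close> gives the superenergy \<open>P1\<close>.\<close>

definition spinor_pairing ::
  "(nat \<Rightarrow> nat \<Rightarrow> complex) \<Rightarrow> (nat \<Rightarrow> nat \<Rightarrow> nat \<Rightarrow> nat \<Rightarrow> complex) \<Rightarrow>
   (nat \<Rightarrow> nat \<Rightarrow> nat \<Rightarrow> nat \<Rightarrow> complex) \<Rightarrow> complex" where
  "spinor_pairing K X Y = (\<Sum>A<2. \<Sum>B<2. \<Sum>C<2. \<Sum>D<2. \<Sum>E<2. \<Sum>F<2. \<Sum>G<2. \<Sum>H<2.
     X A B C D * Y E F G H * K A E * K B F * K C G * K D H)"

text \<open>Components of \<open>X\<close> in the spin frame formed by the columns of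
  \<open>L\<close>.\<close>

definition spinor_transform ::
  "(nat \<Rightarrow> nat \<Rightarrow> complex) \<Rightarrow> (nat \<Rightarrow> nat \<Rightarrow> nat \<Rightarrow> nat \<Rightarrow> complex) \<Rightarrow>
   nat \<Rightarrow> nat \<Rightarrow> nat \<Rightarrow> nat \<Rightarrow> complex" where
  "spinor_transform L X P Q R S = (\<Sum>A<2. \<Sum>B<2. \<Sum>C<2. \<Sum>D<2.
     X A B C D * L A P * L B Q * L C R * L D S)"

lemma invariant_I_pairing: "invariant_I Psi = spinor_pairing eps Psi Psi"
  unfolding invariant_I_def spinor_pairing_def
  by (simp only: mult_ac)

lemma P1_pairing:
  "P1 Psi t = Re (spinor_pairing (vec_spinor t) Psi (\<lambda>A B C D. cnj (Psi A B C D)))"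
proof -
  define br where "br a b c d =
     (\<Sum>A<2. \<Sum>A'<2. \<Sum>B<2. \<Sum>B'<2. \<Sum>C<2. \<Sum>C'<2. \<Sum>D<2. \<Sum>D'<2.
        Psi A B C D * cnj (Psi A' B' C' D') *
        sol a A A' * sol b B B' * sol c C C' * sol d D D')" for a b c d
  have "P1 Psi t = (\<Sum>a<4. \<Sum>b<4. \<Sum>c<4. \<Sum>d<4. Re (br a b c d * complex_of_real (t d) *
      complex_of_real (t c) * complex_of_real (t b) * complex_of_real (t a)))"
    unfolding P1_def bel_robinson_def br_def[symmetric]
    by (intro sum.cong refl) simp
  also have "\<dots> = Re (\<Sum>a<4. (\<Sum>b<4. (\<Sum>c<4. (\<Sum>d<4. br a b c d * complex_of_real (t d)) *
      complex_of_real (t c)) * complex_of_real (t b)) * complex_of_real (t a))"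
    by (simp only: Re_sum sum_distrib_right)
  also have "\<dots> = Re (spinor_pairing (vec_spinor t) Psi (\<lambda>A B C D. cnj (Psi A B C D)))"
    unfolding spinor_pairing_def br_def
    by (simp only: sum_contract sum_contract_sol, subst sum_deinterleave, rule refl)
  finally show ?thesis .
qed

text \<open>Four separate matrices allow the index pairs to be transformed one at a time.\<close>

definition pairing4 ::
  "(nat \<Rightarrow> nat \<Rightarrow> complex) \<Rightarrow> (nat \<Rightarrow> nat \<Rightarrow> complex) \<Rightarrow> (nat \<Rightarrow> nat \<Rightarrow> complex) \<Rightarrow> (nat \<Rightarrow> nat \<Rightarrow> complex) \<Rightarrow>
   (nat \<Rightarrow> nat \<Rightarrow> nat \<Rightarrow> nat \<Rightarrow> complex) \<Rightarrow>
   (nat \<Rightarrow> nat \<Rightarrow> nat \<Rightarrow> nat \<Rightarrow> complex) \<Rightarrow> complex" where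
  "pairing4 K1 K2 K3 K4 X Y = (\<Sum>A<2. \<Sum>E<2. \<Sum>B<2. \<Sum>F<2. \<Sum>C<2. \<Sum>G<2. \<Sum>D<2. \<Sum>H<2.
     X A B C D * Y E F G H * K1 A E * K2 B F * K3 C G * K4 D H)"

text \<open>Transforms the last spinor index and moves it to the front, so that four applications transform
  all indices and restore their order.\<close>
definition rotate_transform ::
  "(nat \<Rightarrow> nat \<Rightarrow> complex) \<Rightarrow> (nat \<Rightarrow> nat \<Rightarrow> nat \<Rightarrow> nat \<Rightarrow> complex) \<Rightarrow>
   nat \<Rightarrow> nat \<Rightarrow> nat \<Rightarrow> nat \<Rightarrow> complex" where
  "rotate_transform L X S A B C = (\<Sum>D<2. X A B C D * L D S)"

lemma spinor_pairing_eq: "spinor_pairing K X Y = pairing4 K K K K X Y"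
  unfolding spinor_pairing_def pairing4_def by (rule sum_deinterleave[symmetric])

lemma spinor_transform_eq:
  "spinor_transform L X = rotate_transform L (rotate_transform L (rotate_transform L (rotate_transform L X)))"
  by (intro ext) (simp add: spinor_transform_def rotate_transform_def sum_distrib_left sum_distrib_right mult_ac)

lemma sum_rotate_pairs:
  fixes f :: "nat \<Rightarrow> nat \<Rightarrow> nat \<Rightarrow> nat \<Rightarrow> nat \<Rightarrow> nat \<Rightarrow> nat \<Rightarrow> nat \<Rightarrow> complex"
  shows "(\<Sum>A<2. \<Sum>E<2. \<Sum>B<2. \<Sum>F<2. \<Sum>C<2. \<Sum>G<2. \<Sum>S<2. \<Sum>Z<2. f A E B F C G S Z)
       = (\<Sum>S<2. \<Sum>Z<2. \<Sum>A<2. \<Sum>E<2. \<Sum>B<2. \<Sum>F<2. \<Sum>C<2. \<Sum>G<2. f A E B F C G S Z)"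
  by (simp only: sum_lessThan_2 ac_simps)

text \<open>The factors \<open>L\<close> and \<open>M\<close> of the last matrix are absorbed by the
  spinors. Since \<open>rotate_transform\<close> moves the treated index to the front, the reduced
  matrix moves to the first slot.\<close>

lemma pairing4_rotate:
  assumes K': "\<And>D H. \<lbrakk>D < 2; H < 2\<rbrakk> \<Longrightarrow> K4' D H = (\<Sum>S<2. \<Sum>Z<2. L D S * M H Z * K4 S Z)"
  shows "pairing4 K1 K2 K3 K4' X Y = pairing4 K4 K1 K2 K3 (rotate_transform L X) (rotate_transform M Y)"
proof -
  have inner: "(\<Sum>D<2. \<Sum>H<2. X A B C D * Y E F G H * k1 * k2 * k3 * K4' D H) =
    (\<Sum>S<2. \<Sum>Z<2. rotate_transform L X S A B C * rotate_transform M Y Z E F G * K4 S Z * k1 * k2 * k3)"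
    for A B C E F G k1 k2 k3
    by (simp add: K' rotate_transform_def sum_lessThan_2 algebra_simps)
  show ?thesis
    unfolding pairing4_def inner by (rule sum_rotate_pairs)
qed

text \<open>Each rotation trades the last \<open>K'\<close> for a \<open>K\<close> in front; after
  four rotations every slot holds \<open>K\<close> and the index order is restored.\<close>

lemma spinor_pairing_transform:
  assumes K': "\<And>D H. \<lbrakk>D < 2; H < 2\<rbrakk> \<Longrightarrow> K' D H = (\<Sum>S<2. \<Sum>Z<2. L D S * M H Z * K S Z)"
  shows "spinor_pairing K' X Y = spinor_pairing K (spinor_transform L X) (spinor_transform M Y)"
  unfolding spinor_pairing_eq spinor_transform_eq
  by (simp only: pairing4_rotate[of K' L M K, OF K'])

text \<open>Adjacent swaps sort the indices. Read as rewrite rules, the equations leave only the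
  five sorted components.\<close>

lemma totally_symmetric_components:
  assumes "totally_symmetric F"
  shows "F 0 0 1 0 = F 0 0 0 1" "F 0 1 0 0 = F 0 0 0 1" "F 0 1 0 1 = F 0 0 1 1"
    "F 0 1 1 0 = F 0 0 1 1" "F 1 0 0 0 = F 0 0 0 1" "F 1 0 0 1 = F 0 0 1 1"
    "F 1 0 1 0 = F 0 0 1 1" "F 1 0 1 1 = F 0 1 1 1" "F 1 1 0 0 = F 0 0 1 1"
    "F 1 1 0 1 = F 0 1 1 1" "F 1 1 1 0 = F 0 1 1 1"
proof -
  have sym: "F A B C D = F B A C D" "F A B C D = F A C B D" "F A B C D = F A B D C"
    if "A < 2" "B < 2" "C < 2" "D < 2" for A B C D
    using assms that unfolding totally_symmetric_def by blast+
  show "F 0 0 1 0 = F 0 0 0 1" "F 0 1 0 0 = F 0 0 0 1" "F 0 1 0 1 = F 0 0 1 1"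
    "F 0 1 1 0 = F 0 0 1 1" "F 1 0 0 0 = F 0 0 0 1" "F 1 0 0 1 = F 0 0 1 1"
    "F 1 0 1 0 = F 0 0 1 1" "F 1 0 1 1 = F 0 1 1 1" "F 1 1 0 0 = F 0 0 1 1"
    "F 1 1 0 1 = F 0 1 1 1" "F 1 1 1 0 = F 0 1 1 1"
    using sym[of 0 0 0 1] sym[of 0 0 1 0] sym[of 0 1 0 0] sym[of 1 0 0 0] sym[of 0 0 1 1] sym[of 0 1 0 1]
      sym[of 0 1 1 0] sym[of 1 0 0 1] sym[of 1 0 1 0] sym[of 0 1 1 1] sym[of 1 0 1 1] sym[of 1 1 0 1]
      sym[of 1 1 1 0]
    by simp_all
qed

lemma totally_symmetric_transform:
  assumes "totally_symmetric X"
  shows "totally_symmetric (spinor_transform L X)"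
  unfolding totally_symmetric_def
proof (intro allI impI conjI)
  fix P Q R S :: nat
  note sym = totally_symmetric_components[OF assms]
  show "spinor_transform L X P Q R S = spinor_transform L X Q P R S"
    "spinor_transform L X P Q R S = spinor_transform L X P R Q S"
    "spinor_transform L X P Q R S = spinor_transform L X P Q S R"
    by (simp_all add: spinor_transform_def sum_lessThan_2 sym[simplified] algebra_simps)
qed

text \<open>For 2 by 2 matrices, \<open>L\<close> acts on \<open>eps\<close> as multiplication by
  its determinant.\<close>

lemma eps_transform:
  assumes "L 0 0 * L 1 1 - L 0 1 * L 1 0 = 1" "A < 2" "B < 2"
  shows "eps A B = (\<Sum>P<2. \<Sum>Q<2. L A P * L B Q * eps P Q)"
  using assms by (auto simp: eps_def sum_lessThan_2 algebra_simps numeral_2_eq_2 less_Suc_eq)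

section \<open>The electric spinor in the adapted frame\<close>

lemma sum_move_pair_inside:
  fixes f :: "nat \<Rightarrow> nat \<Rightarrow> nat \<Rightarrow> nat \<Rightarrow> nat \<Rightarrow> nat \<Rightarrow> complex"
  shows "(\<Sum>Q<2. \<Sum>R<2. \<Sum>A<2. \<Sum>B<2. \<Sum>C<2. \<Sum>D<2. f Q R A B C D) =
    (\<Sum>A<2. \<Sum>B<2. \<Sum>C<2. \<Sum>D<2. \<Sum>Q<2. \<Sum>R<2. f Q R A B C D)"
  by (simp only: sum_lessThan_2 ac_simps)

text \<open>In the frame \<open>L\<close> the vector is \<open>r\<close> times the identity, so
  contracting with it identifies primed with unprimed indices. Its two occurrences give
  \<open>r * r = 1 / 2\<close>.\<close>

lemma electric_spinor_transform:
  assumes det: "L 0 0 * L 1 1 - L 0 1 * L 1 0 = 1" and r: "r * r = 1 / 2"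
    and T: "\<And>A A'. \<lbrakk>A < 2; A' < 2\<rbrakk> \<Longrightarrow> T A A' = r * (\<Sum>P<2. L A P * cnj (L A' P))"
    and "P' < 2" "S' < 2"
  shows "(\<Sum>A<2. \<Sum>A'<2. \<Sum>D<2. \<Sum>D'<2. electric_spinor X T A A' D D' *
            (L A P * cnj (L A' P')) * (L D S * cnj (L D' S')))
       = 1 / 2 * (\<Sum>Q<2. \<Sum>R<2. spinor_transform L X P Q R S * eps P' Q * eps R S')"
proof -
  have det': "cnj (L 0 0) * cnj (L 1 1) - cnj (L 0 1) * cnj (L 1 0) = 1"
    using arg_cong[OF det, of cnj] by simp
  have cnj_eps_transform: "(\<Sum>A'<2. \<Sum>B'<2. eps A' B' * cnj (L A' P) * cnj (L B' Q)) = eps P Q"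
    if "P < 2" "Q < 2" for P Q
    using that det' by (auto simp: eps_def sum_lessThan_2 algebra_simps numeral_2_eq_2 less_Suc_eq)
  \<comment> \<open>\<open>U\<close> and \<open>V\<close> collect everything primed. Invariance of
    \<open>eps\<close> under the conjugate of \<open>L\<close> collapses each to a single
    sum.\<close>
  define U where "U B = (\<Sum>A'<2. \<Sum>B'<2. eps A' B' * T B B' * cnj (L A' P'))" for B
  define V where "V C = (\<Sum>C'<2. \<Sum>D'<2. eps C' D' * T C C' * cnj (L D' S'))" for C
  have U: "U B = r * (\<Sum>Q<2. L B Q * eps P' Q)" if "B < 2" for B
  proof -
    have "U B = r * (\<Sum>Q<2. L B Q * (\<Sum>A'<2. \<Sum>B'<2. eps A' B' * cnj (L A' P') * cnj (L B' Q)))"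
      unfolding U_def using that by (simp add: T sum_lessThan_2 algebra_simps)
    then show ?thesis using \<open>P' < 2\<close> by (simp add: cnj_eps_transform)
  qed
  have V: "V C = r * (\<Sum>R<2. L C R * eps R S')" if "C < 2" for C
  proof -
    have "V C = r * (\<Sum>R<2. L C R * (\<Sum>C'<2. \<Sum>D'<2. eps C' D' * cnj (L C' R) * cnj (L D' S')))"
      unfolding V_def using that by (simp add: T sum_lessThan_2 algebra_simps)
    then show ?thesis using \<open>S' < 2\<close> by (simp add: cnj_eps_transform)
  qed
  have "(\<Sum>A<2. \<Sum>A'<2. \<Sum>D<2. \<Sum>D'<2. electric_spinor X T A A' D D' *
            (L A P * cnj (L A' P')) * (L D S * cnj (L D' S')))
     = (\<Sum>A<2. \<Sum>B<2. \<Sum>C<2. \<Sum>D<2. \<Sum>A'<2. \<Sum>B'<2. \<Sum>C'<2. \<Sum>D'<2.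
          X A B C D * eps A' B' * eps C' D' * T B B' * T C C' *
            (L A P * cnj (L A' P')) * (L D S * cnj (L D' S')))"
    unfolding electric_spinor_def sum_distrib_right by (rule sum_deinterleave_outer_first)
  also have "\<dots> = (\<Sum>A<2. \<Sum>B<2. \<Sum>C<2. \<Sum>D<2. X A B C D * L A P * L D S * U B * V C)"
    unfolding U_def V_def
    by (intro sum.cong refl) (simp add: sum_lessThan_2 algebra_simps)
  also have "\<dots> = (\<Sum>A<2. \<Sum>B<2. \<Sum>C<2. \<Sum>D<2. (r * r) * (\<Sum>Q<2. \<Sum>R<2.
      X A B C D * L A P * L B Q * L C R * L D S * eps P' Q * eps R S'))"
    by (intro sum.cong refl) (simp add: U V sum_lessThan_2 algebra_simps)
  also have "\<dots> = (r * r) * (\<Sum>Q<2. \<Sum>R<2. spinor_transform L X P Q R S * eps P' Q * eps R S')"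
    unfolding spinor_transform_def sum_distrib_right
    by (subst sum_move_pair_inside) (simp only: sum_distrib_left)
  finally show ?thesis by (simp add: r)
qed

section \<open>Families that detect the vanishing of a spinor\<close>

text \<open>Equivalently, the matrices \<open>g j\<close> span all 2 by 2 complex matrices.\<close>

definition separating :: "'j set \<Rightarrow> ('j \<Rightarrow> nat \<Rightarrow> nat \<Rightarrow> complex) \<Rightarrow> bool" where
  "separating J g \<longleftrightarrow> (\<forall>h. (\<forall>j\<in>J. (\<Sum>A<2. \<Sum>A'<2. h A A' * g j A A') = 0) \<longrightarrow> (\<forall>A<2. \<forall>A'<2. h A A' = 0))"

text \<open>Products of a separating family with itself separate: for fixed \<open>k\<close> the
  first index pair is freed, then the second.\<close>

lemma separating_pairs:
  assumes "separating J g"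
  shows "(\<forall>j\<in>J. \<forall>k\<in>J. (\<Sum>A<2. \<Sum>A'<2. \<Sum>D<2. \<Sum>D'<2. h A A' D D' * g j A A' * g k D D') = 0)
    \<longleftrightarrow> (\<forall>A<2. \<forall>A'<2. \<forall>D<2. \<forall>D'<2. h A A' D D' = 0)" (is "?l \<longleftrightarrow> ?r")
proof
  assume l: ?l
  have sep: "\<forall>A<2. \<forall>A'<2. f A A' = 0" if "\<forall>j\<in>J. (\<Sum>A<2. \<Sum>A'<2. f A A' * g j A A') = 0" for f
    using assms that unfolding separating_def by blast
  define h1 where "h1 k A A' = (\<Sum>D<2. \<Sum>D'<2. h A A' D D' * g k D D')" for k A A'
  have "(\<Sum>A<2. \<Sum>A'<2. h1 k A A' * g j A A') = 0" if "j \<in> J" "k \<in> J" for j k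
    using l that unfolding h1_def sum_distrib_right by (simp add: sum_distrib_left mult_ac)
  then have "\<forall>A<2. \<forall>A'<2. h1 k A A' = 0" if "k \<in> J" for k
    using that sep[of "h1 k"] by simp
  then have "\<forall>k\<in>J. (\<Sum>D<2. \<Sum>D'<2. h A A' D D' * g k D D') = 0" if "A < 2" "A' < 2" for A A'
    using that unfolding h1_def by simp
  then show ?r using sep[of "h _ _"] by simp
qed simp

text \<open>Up to scale and sign these are the identity and the Pauli matrices, a basis of the 2 by
  2 matrices.\<close>

lemma separating_sol: "separating {..<4} sol"
  unfolding separating_def
proof (intro allI impI)
  fix h and A A' :: nat
  assume h: "\<forall>a\<in>{..<4}. (\<Sum>A<2. \<Sum>A'<2. h A A' * sol a A A') = 0" and "A < 2" "A' < 2"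
  have "h 0 0 + h 1 1 = 0" using h[rule_format, of 0]
    by (simp add: sum_lessThan_2 sol_def add_divide_distrib[symmetric])
  moreover have "h 0 1 + h 1 0 = 0" using h[rule_format, of 1]
    by (simp add: sum_lessThan_2 sol_def add_divide_distrib[symmetric])
  moreover have "h 0 1 - h 1 0 = 0" using h[rule_format, of 2]
    by (simp add: sum_lessThan_2 sol_def diff_divide_distrib[symmetric] left_diff_distrib[symmetric])
  moreover have "h 0 0 - h 1 1 = 0" using h[rule_format, of 3]
    by (simp add: sum_lessThan_2 sol_def diff_divide_distrib[symmetric])
  ultimately have "h 0 0 = 0 \<and> h 0 1 = 0 \<and> h 1 0 = 0 \<and> h 1 1 = 0"
    by (simp add: complex_eq_iff)
  then show "h A A' = 0" using \<open>A < 2\<close> \<open>A' < 2\<close> by (auto simp: numeral_2_eq_2 less_Suc_eq)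
qed

lemma separating_transform:
  fixes L :: "nat \<Rightarrow> nat \<Rightarrow> complex"
  assumes det: "L 0 0 * L 1 1 - L 0 1 * L 1 0 = 1"
  shows "separating ({..<2} \<times> {..<2}) (\<lambda>(P, P') A A'. L A P * cnj (L A' P'))"
  unfolding separating_def
proof (intro allI impI)
  have kernel: "h A = 0" if "(\<Sum>A<2. h A * M A 0) = 0" "(\<Sum>A<2. h A * M A 1) = 0" "A < 2"
      and "M 0 0 * M 1 1 - M 0 1 * M 1 0 = 1" for h A and M :: "nat \<Rightarrow> nat \<Rightarrow> complex"
  proof -
    \<comment> \<open>Cramer's rule: the system is multiplied by the adjugate of
      \<open>M\<close>.\<close>
    have "h 0 * (M 0 0 * M 1 1 - M 0 1 * M 1 0) = (\<Sum>A<2. h A * M A 0) * M 1 1 - (\<Sum>A<2. h A * M A 1) * M 1 0"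
      "h 1 * (M 0 0 * M 1 1 - M 0 1 * M 1 0) = (\<Sum>A<2. h A * M A 1) * M 0 0 - (\<Sum>A<2. h A * M A 0) * M 0 1"
      by (simp_all add: sum_lessThan_2 algebra_simps)
    then show ?thesis using that by (auto simp: numeral_2_eq_2 less_Suc_eq)
  qed
  fix h and A A' :: nat
  assume h: "\<forall>j\<in>{..<2} \<times> {..<2}. (\<Sum>A<2. \<Sum>A'<2. h A A' * (case j of (P, P') \<Rightarrow> \<lambda>A A'. L A P * cnj (L A' P')) A A') = 0"
    and "A < 2" "A' < 2"
  have "(\<Sum>A<2. (\<Sum>A'<2. h A A' * cnj (L A' P')) * L A P) = 0" if "P < 2" "P' < 2" for P P' :: nat
    using h[rule_format, of "(P, P')"] that by (simp add: sum_distrib_left sum_distrib_right mult_ac)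
  then have "(\<Sum>A'<2. h A A' * cnj (L A' P')) = 0" if "P' < 2" for P'
    using kernel[of "\<lambda>A. \<Sum>A'<2. h A A' * cnj (L A' P')" L A] that \<open>A < 2\<close> det by simp
  then show "h A A' = 0"
    using kernel[of "h A" "\<lambda>A P. cnj (L A P)" A'] \<open>A' < 2\<close> arg_cong[OF det, of cnj] by simp
qed

section \<open>The spin frame adapted to the vector\<close>

lemma vec_spinor_cholesky:
  assumes "(\<Sum>a<4. eta a * (t a)\<^sup>2) = 1"
  obtains L :: "nat \<Rightarrow> nat \<Rightarrow> complex" and r where "L 0 0 * L 1 1 - L 0 1 * L 1 0 = (1::complex)" "r * r = 1 / 2"
    "\<And>A A'. \<lbrakk>A < 2; A' < 2\<rbrakk> \<Longrightarrow> vec_spinor t A A' = r * (\<Sum>P<2. L A P * cnj (L A' P))"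
proof -
  \<comment> \<open>The unit condition read as a determinant; it keeps the pivot
    \<open>t 0 + t 3\<close> away from zero.\<close>
  have prod: "(t 0 + t 3) * (t 0 - t 3) = 1 + (t 1)\<^sup>2 + (t 2)\<^sup>2"
    using assms by (simp add: sum_lessThan_4 eta_def power2_eq_square algebra_simps)
  have "1 + (t 1)\<^sup>2 + (t 2)\<^sup>2 > 0" by (smt (verit) zero_le_power2)
  with prod have nz: "t 0 + t 3 \<noteq> 0" by auto
  \<comment> \<open>The sign covers future and past directed vectors alike; it enters
    \<open>r\<close>, whose square is \<open>1 / 2\<close> either way.\<close>
  define s where "s = sgn (t 0 + t 3)"
  define q where "q = sqrt \<bar>t 0 + t 3\<bar>"
  have q: "q > 0" "s * (q * q) = t 0 + t 3" "s * s = 1"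
    using nz by (auto simp: s_def q_def sgn_if)
  define b where "b = Complex (t 1) (- t 2)"
  \<comment> \<open>Lower triangular Cholesky factor: the diagonal \<open>q\<close>,
    \<open>1 / q\<close> forces determinant 1, and \<open>b\<close> is the lower left entry of the
    vector's matrix without its factor \<open>1 / sqrt 2\<close>.\<close>
  define L where "L A P = (if A = 0 then (if P = 0 then complex_of_real q else 0)
     else if P = 0 then complex_of_real (s / q) * b else complex_of_real (1 / q))" for A P :: nat
  define r where "r = complex_of_real (s / sqrt 2)"
  have bb: "b * cnj b = complex_of_real ((t 1)\<^sup>2 + (t 2)\<^sup>2)"
    by (simp add: b_def complex_eq_iff power2_eq_square)
  \<comment> \<open>The lower right entry, the only place where the factorisation uses the
    determinant condition \<open>prod\<close>.\<close>
  have last: "s / q * (s / q) * ((t 1)\<^sup>2 + (t 2)\<^sup>2) + 1 / q * (1 / q) = s * (t 0 - t 3)"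
  proof -
    have "s / q * (s / q) * ((t 1)\<^sup>2 + (t 2)\<^sup>2) + 1 / q * (1 / q) = ((t 0 + t 3) * (t 0 - t 3)) / (q * q)"
      using q(1) unfolding prod by (simp add: field_simps) (metis q(3) mult.assoc mult_1)
    also have "\<dots> = s * (t 0 - t 3)"
      using q(1) unfolding q(2)[symmetric] by simp
    finally show ?thesis .
  qed
  show thesis
  proof
    show "L 0 0 * L 1 1 - L 0 1 * L 1 0 = 1" using q(1) by (simp add: L_def)
    show "r * r = 1 / 2"
    proof -
      have "s / sqrt 2 * (s / sqrt 2) = 1 / 2" using q(3) by simp
      then show ?thesis unfolding r_def by (metis of_real_mult of_real_divide of_real_1 of_real_numeral)
    qed
    fix A A' :: nat
    assume "A < 2" "A' < 2"
    have v00: "vec_spinor t 0 0 = complex_of_real (t 0 + t 3) / complex_of_real (sqrt 2)"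
      and v01: "vec_spinor t 0 1 = cnj b / complex_of_real (sqrt 2)"
      and v10: "vec_spinor t 1 0 = b / complex_of_real (sqrt 2)"
      and v11: "vec_spinor t 1 1 = complex_of_real (t 0 - t 3) / complex_of_real (sqrt 2)"
      by (simp_all add: vec_spinor_def sum_lessThan_4 sol_def b_def complex_eq_iff field_simps)
    have "r * (\<Sum>P<2. L 0 P * cnj (L 0 P)) = complex_of_real (s * (q * q)) / complex_of_real (sqrt 2)"
      by (simp add: sum_lessThan_2 L_def r_def)
    then have e00: "r * (\<Sum>P<2. L 0 P * cnj (L 0 P)) = vec_spinor t 0 0"
      by (simp only: v00 q)
    have "r * (\<Sum>P<2. L 0 P * cnj (L 1 P)) = complex_of_real (s * s) * cnj b / complex_of_real (sqrt 2)"
      "r * (\<Sum>P<2. L 1 P * cnj (L 0 P)) = complex_of_real (s * s) * b / complex_of_real (sqrt 2)"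
      using q(1) by (simp_all add: sum_lessThan_2 L_def r_def)
    then have e01: "r * (\<Sum>P<2. L 0 P * cnj (L 1 P)) = vec_spinor t 0 1"
      and e10: "r * (\<Sum>P<2. L 1 P * cnj (L 0 P)) = vec_spinor t 1 0"
      by (simp_all only: v01 v10 q of_real_1 mult_1)
    have "(\<Sum>P<2. L 1 P * cnj (L 1 P)) = complex_of_real (s / q * (s / q)) * (b * cnj b) + complex_of_real (1 / q * (1 / q))"
      by (simp add: sum_lessThan_2 L_def)
    also have "\<dots> = complex_of_real (s / q * (s / q) * ((t 1)\<^sup>2 + (t 2)\<^sup>2) + 1 / q * (1 / q))"
      unfolding bb by (simp only: of_real_mult of_real_add)
    also have "\<dots> = complex_of_real (s * (t 0 - t 3))"
      by (simp only: last)
    finally have "r * (\<Sum>P<2. L 1 P * cnj (L 1 P)) = complex_of_real (s * s) * complex_of_real (t 0 - t 3) / complex_of_real (sqrt 2)"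
      by (simp add: r_def)
    then have e11: "r * (\<Sum>P<2. L 1 P * cnj (L 1 P)) = vec_spinor t 1 1"
      by (simp only: v11 q of_real_1 mult_1)
    from \<open>A < 2\<close> \<open>A' < 2\<close> show "vec_spinor t A A' = r * (\<Sum>P<2. L A P * cnj (L A' P))"
      using e00 e01 e10 e11 by (auto simp: numeral_2_eq_2 less_Suc_eq)
  qed
qed

section \<open>Invariant, superenergy and electric part in five components\<close>

text \<open>The multiplicities 1, 4, 6, 4, 1 count index tuples by their number of ones.
  \<open>eps\<close> pairs complementary tuples with a sign for each one in the first; the diagonal
  matrix pairs equal tuples.\<close>

lemma pairing_components:
  assumes "totally_symmetric F"
  shows "spinor_pairing eps F F = 2 * F 0 0 0 0 * F 1 1 1 1 - 8 * F 0 0 0 1 * F 0 1 1 1 + 6 * F 0 0 1 1 * F 0 0 1 1"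
    and "spinor_pairing (\<lambda>A B. if A = B then r else 0) F (\<lambda>A B C D. cnj (F A B C D)) =
      r * r * r * r * complex_of_real ((cmod (F 0 0 0 0))\<^sup>2 + 4 * (cmod (F 0 0 0 1))\<^sup>2 + 6 * (cmod (F 0 0 1 1))\<^sup>2 +
        4 * (cmod (F 0 1 1 1))\<^sup>2 + (cmod (F 1 1 1 1))\<^sup>2)"
proof -
  note sym = totally_symmetric_components[OF assms(1)]
  show "spinor_pairing eps F F = 2 * F 0 0 0 0 * F 1 1 1 1 - 8 * F 0 0 0 1 * F 0 1 1 1 + 6 * F 0 0 1 1 * F 0 0 1 1"
    by (simp add: spinor_pairing_def sum_lessThan_2 sym[simplified] eps_def)
  show "spinor_pairing (\<lambda>A B. if A = B then r else 0) F (\<lambda>A B C D. cnj (F A B C D)) =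
      r * r * r * r * complex_of_real ((cmod (F 0 0 0 0))\<^sup>2 + 4 * (cmod (F 0 0 0 1))\<^sup>2 + 6 * (cmod (F 0 0 1 1))\<^sup>2 +
        4 * (cmod (F 0 1 1 1))\<^sup>2 + (cmod (F 1 1 1 1))\<^sup>2)"
    unfolding of_real_add of_real_mult complex_norm_square
    by (simp add: spinor_pairing_def sum_lessThan_2 sym[simplified] algebra_simps)
qed

text \<open>\<open>eps\<close> forces \<open>Q\<close> and \<open>R\<close> to be the complements of
  \<open>P'\<close> and \<open>S'\<close>. If the first component then has \<open>k\<close> ones
  among its indices, the conjugated one has \<open>4 - k\<close>.\<close>

lemma electric_components:
  assumes "totally_symmetric F"
  shows "(\<forall>P<2. \<forall>P'<2. \<forall>S<2. \<forall>S'<2.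
      (\<Sum>Q<2. \<Sum>R<2. F P Q R S * eps P' Q * eps R S') +
      cnj (\<Sum>Q<2. \<Sum>R<2. F P' Q R S' * eps P Q * eps R S) = 0)
    \<longleftrightarrow> F 0 0 0 0 + cnj (F 1 1 1 1) = 0 \<and> F 0 0 0 1 - cnj (F 0 1 1 1) = 0 \<and>
       F 0 0 1 1 + cnj (F 0 0 1 1) = 0" (is "?l \<longleftrightarrow> ?r")
proof -
  note simps = sum_lessThan_2 eps_def totally_symmetric_components[OF assms, simplified]
  show ?thesis
  proof
    assume l: ?l
    show ?r
      \<comment> \<open>These choices of free indices give \<open>k = 0\<close>,
        \<open>k = 1\<close> and \<open>k = 2\<close>.\<close>
      using l[rule_format, of 0 1 0 1] l[rule_format, of 0 1 0 0] l[rule_format, of 0 0 1 1]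
      by (simp add: simps complex_eq_iff)
  next
    assume ?r
    then have "F 1 1 1 1 = - cnj (F 0 0 0 0)" "F 0 1 1 1 = cnj (F 0 0 0 1)" "cnj (F 0 0 1 1) = - F 0 0 1 1"
      by (auto simp: complex_eq_iff)
    then show ?l
      by (auto simp: numeral_2_eq_2 less_Suc_eq simps[simplified numeral_2_eq_2])
  qed
qed

section \<open>The inequality for five complex numbers\<close>

text \<open>The cross term of \<open>cmod (x + cnj y)\<close> squared is
  \<open>2 * Re (x * y)\<close>, so the conjugations produce the bilinear invariant. A phase
  preserves the moduli and multiplies the invariant by its square.\<close>

lemma quartic_defect:
  fixes f0 f1 f2 f3 f4 v :: complex
  assumes "cmod v = 1"
  shows "(cmod (v * f0 + cnj (v * f4)))\<^sup>2 + 4 * (cmod (v * f1 - cnj (v * f3)))\<^sup>2 + 3 * (cmod (v * f2 + cnj (v * f2)))\<^sup>2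
    = (cmod f0)\<^sup>2 + 4 * (cmod f1)\<^sup>2 + 6 * (cmod f2)\<^sup>2 + 4 * (cmod f3)\<^sup>2 + (cmod f4)\<^sup>2
      + Re (v * v * (2 * f0 * f4 - 8 * f1 * f3 + 6 * f2 * f2))"
proof -
  have *: "(cmod (g0 + cnj g4))\<^sup>2 + 4 * (cmod (g1 - cnj g3))\<^sup>2 + 3 * (cmod (g2 + cnj g2))\<^sup>2
    = (cmod g0)\<^sup>2 + 4 * (cmod g1)\<^sup>2 + 6 * (cmod g2)\<^sup>2 + 4 * (cmod g3)\<^sup>2 + (cmod g4)\<^sup>2
      + Re (2 * g0 * g4 - 8 * g1 * g3 + 6 * g2 * g2)" for g0 g1 g2 g3 g4
    unfolding cmod_power2 by (simp add: power2_eq_square algebra_simps)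
  have n: "(cmod (v * f))\<^sup>2 = (cmod f)\<^sup>2" for f by (simp add: norm_mult assms)
  show ?thesis unfolding * n by (rule arg_cong[where f="\<lambda>x. _ + Re x"]) (simp add: algebra_simps)
qed

lemma quartic_inequality:
  fixes f0 f1 f2 f3 f4 :: complex
  defines "I \<equiv> 2 * f0 * f4 - 8 * f1 * f3 + 6 * f2 * f2"
    and "N \<equiv> (cmod f0)\<^sup>2 + 4 * (cmod f1)\<^sup>2 + 6 * (cmod f2)\<^sup>2 + 4 * (cmod f3)\<^sup>2 + (cmod f4)\<^sup>2"
  shows "cmod I \<le> N"
    and "N = cmod I \<longleftrightarrow> (\<exists>v. cmod v = 1 \<and> v * f0 + cnj (v * f4) = 0 \<and> v * f1 - cnj (v * f3) = 0
           \<and> v * f2 + cnj (v * f2) = 0)"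
proof -
  define D where "D v = (cmod (v * f0 + cnj (v * f4)))\<^sup>2 + 4 * (cmod (v * f1 - cnj (v * f3)))\<^sup>2
      + 3 * (cmod (v * f2 + cnj (v * f2)))\<^sup>2" for v
  have D: "D v = N + Re (v * v * I)" if "cmod v = 1" for v
    unfolding D_def N_def I_def by (rule quartic_defect[OF that])
  have D_nonneg: "D v \<ge> 0" for v by (simp add: D_def)
  have D_0: "D v = 0 \<longleftrightarrow> v * f0 + cnj (v * f4) = 0 \<and> v * f1 - cnj (v * f3) = 0 \<and> v * f2 + cnj (v * f2) = 0" for v
  proof -
    have "x\<^sup>2 + 4 * y\<^sup>2 + 3 * z\<^sup>2 = 0 \<longleftrightarrow> x = 0 \<and> y = 0 \<and> z = 0" for x y z :: real
      by (smt (verit) zero_le_power2 zero_eq_power2)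
    then show ?thesis unfolding D_def by simp
  qed
  \<comment> \<open>Half the angle that turns \<open>I\<close> onto the negative real axis, since
    \<open>u\<close> enters squared.\<close>
  define u where "u = cis ((pi - Arg I) / 2)"
  have u: "cmod u = 1" "u * u * I = - complex_of_real (cmod I)"
  proof -
    have "u * u * I = cis (pi - Arg I) * (complex_of_real (cmod I) * cis (Arg I))"
      by (simp add: u_def cis_mult flip: rcis_def) (simp add: rcis_cmod_Arg)
    also have "\<dots> = complex_of_real (cmod I) * cis pi"
      by (simp add: cis_mult mult.left_commute)
    finally show "u * u * I = - complex_of_real (cmod I)" by simp
  qed (simp add: u_def)
  have Du: "D u = N - cmod I" using D[OF u(1)] u(2) by simp
  then show le: "cmod I \<le> N" using D_nonneg[of u] by simp
  show "N = cmod I \<longleftrightarrow> (\<exists>v. cmod v = 1 \<and> v * f0 + cnj (v * f4) = 0 \<and> v * f1 - cnj (v * f3) = 0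
           \<and> v * f2 + cnj (v * f2) = 0)"
  proof
    assume "N = cmod I"
    then have "D u = 0" by (simp add: Du)
    then show "\<exists>v. cmod v = 1 \<and> v * f0 + cnj (v * f4) = 0 \<and> v * f1 - cnj (v * f3) = 0
           \<and> v * f2 + cnj (v * f2) = 0" using u(1) D_0 by blast
  next
    assume "\<exists>v. cmod v = 1 \<and> v * f0 + cnj (v * f4) = 0 \<and> v * f1 - cnj (v * f3) = 0
           \<and> v * f2 + cnj (v * f2) = 0"
    then obtain v where v: "cmod v = 1" "D v = 0" using D_0 by blast
    \<comment> \<open>A zero of \<open>D\<close> at any phase suffices: it bounds \<open>N\<close>
      by \<open>cmod I\<close>, the reverse of \<open>le\<close>.\<close>
    have "N = - Re (v * v * I)" using D[OF v(1)] v(2) by simp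
    also have "\<dots> \<le> cmod (v * v * I)" using abs_Re_le_cmod[of "v * v * I"] by linarith
    also have "\<dots> = cmod I" by (simp add: norm_mult v(1))
    finally show "N = cmod I" using le by simp
  qed
qed

section \<open>Vanishing of the rotated electric part\<close>

lemma totally_symmetric_scale:
  "totally_symmetric F \<Longrightarrow> totally_symmetric (\<lambda>A B C D. v * F A B C D)"
  unfolding totally_symmetric_def by simp

text \<open>Both sides say that one Hermitian spinor \<open>h\<close> is zero, tested once against
  \<open>sol\<close> and once against the products of columns of \<open>L\<close>.\<close>

lemma electric_vanishing_iff:
  fixes L :: "nat \<Rightarrow> nat \<Rightarrow> complex"
  assumes sym: "totally_symmetric Psi"
    and det: "L 0 0 * L 1 1 - L 0 1 * L 1 0 = 1" and r: "r * r = 1 / 2"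
    and T: "\<And>A A'. \<lbrakk>A < 2; A' < 2\<rbrakk> \<Longrightarrow> T A A' = r * (\<Sum>P<2. L A P * cnj (L A' P))"
  defines "F \<equiv> spinor_transform L Psi"
  shows "(\<forall>a<4. \<forall>d<4. Re (v * (\<Sum>A<2. \<Sum>A'<2. \<Sum>D<2. \<Sum>D'<2.
            electric_spinor Psi T A A' D D' * sol a A A' * sol d D D')) = 0)
    \<longleftrightarrow> v * F 0 0 0 0 + cnj (v * F 1 1 1 1) = 0 \<and> v * F 0 0 0 1 - cnj (v * F 0 1 1 1) = 0 \<and>
       v * F 0 0 1 1 + cnj (v * F 0 0 1 1) = 0" (is "?l \<longleftrightarrow> ?r")
proof -
  let ?X = "electric_spinor Psi T"
  \<comment> \<open>Adding the conjugate with primed and unprimed indices exchanged turns the real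
    part into a complex linear condition, as \<open>separating\<close> requires.\<close>
  define h where "h A A' D D' = v * ?X A A' D D' + cnj (v * ?X A' A D' D)" for A A' D D'
  have herm: "(\<Sum>A<2. \<Sum>A'<2. \<Sum>D<2. \<Sum>D'<2. h A A' D D' * g A A' * k D D') =
      v * (\<Sum>A<2. \<Sum>A'<2. \<Sum>D<2. \<Sum>D'<2. ?X A A' D D' * g A A' * k D D') +
      cnj (v * (\<Sum>A<2. \<Sum>A'<2. \<Sum>D<2. \<Sum>D'<2. ?X A A' D D' * g' A A' * k' D D'))"
    if "\<And>A A'. cnj (g' A A') = g A' A" "\<And>A A'. cnj (k' A A') = k A' A" for g k g' k'
    unfolding h_def by (simp add: that sum_lessThan_2 algebra_simps)
  have sol_iff: "Re (v * (\<Sum>A<2. \<Sum>A'<2. \<Sum>D<2. \<Sum>D'<2. ?X A A' D D' * sol a A A' * sol d D D')) = 0 \<longleftrightarrow>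
      (\<Sum>A<2. \<Sum>A'<2. \<Sum>D<2. \<Sum>D'<2. h A A' D D' * sol a A A' * sol d D D') = 0" for a d
    unfolding herm[of "sol a" "sol a" "sol d" "sol d", OF cnj_sol cnj_sol] complex_add_cnj
    by (simp only: of_real_eq_0_iff mult_eq_0_iff) simp
  let ?g = "\<lambda>(P, P') A A'. L A P * cnj (L A' P')"
  have "?l \<longleftrightarrow> (\<forall>A<2. \<forall>A'<2. \<forall>D<2. \<forall>D'<2. h A A' D D' = 0)"
    unfolding sol_iff using separating_pairs[OF separating_sol, of h] by (simp add: Ball_def)
  also have "\<dots> \<longleftrightarrow> (\<forall>p\<in>{..<2} \<times> {..<2}. \<forall>s\<in>{..<2} \<times> {..<2}.
      (\<Sum>A<2. \<Sum>A'<2. \<Sum>D<2. \<Sum>D'<2. h A A' D D' * ?g p A A' * ?g s D D') = 0)"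
    by (rule separating_pairs[OF separating_transform[of L, OF det], symmetric])
  also have "\<dots> \<longleftrightarrow> (\<forall>P<2. \<forall>P'<2. \<forall>S<2. \<forall>S'<2.
      (\<Sum>A<2. \<Sum>A'<2. \<Sum>D<2. \<Sum>D'<2. h A A' D D' * (L A P * cnj (L A' P')) * (L D S * cnj (L D' S'))) = 0)"
    by (auto simp: Ball_def)
  also have "\<dots> \<longleftrightarrow> (\<forall>P<2. \<forall>P'<2. \<forall>S<2. \<forall>S'<2.
      (\<Sum>Q<2. \<Sum>R<2. v * F P Q R S * eps P' Q * eps R S') +
      cnj (\<Sum>Q<2. \<Sum>R<2. v * F P' Q R S' * eps P Q * eps R S) = 0)"
  proof -
    have "(\<Sum>A<2. \<Sum>A'<2. \<Sum>D<2. \<Sum>D'<2. h A A' D D' * (L A P * cnj (L A' P')) * (L D S * cnj (L D' S'))) =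
      1 / 2 * ((\<Sum>Q<2. \<Sum>R<2. v * F P Q R S * eps P' Q * eps R S') +
      cnj (\<Sum>Q<2. \<Sum>R<2. v * F P' Q R S' * eps P Q * eps R S))"
      if "P < 2" "P' < 2" "S < 2" "S' < 2" for P P' S S'
    proof -
      have "(\<Sum>A<2. \<Sum>A'<2. \<Sum>D<2. \<Sum>D'<2. h A A' D D' * (L A P * cnj (L A' P')) * (L D S * cnj (L D' S'))) =
        v * (\<Sum>A<2. \<Sum>A'<2. \<Sum>D<2. \<Sum>D'<2. ?X A A' D D' * (L A P * cnj (L A' P')) * (L D S * cnj (L D' S'))) +
        cnj (v * (\<Sum>A<2. \<Sum>A'<2. \<Sum>D<2. \<Sum>D'<2. ?X A A' D D' * (L A P' * cnj (L A' P)) * (L D S' * cnj (L D' S))))"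
        by (rule herm) (simp_all add: mult.commute)
      also have "\<dots> = v * (1 / 2 * (\<Sum>Q<2. \<Sum>R<2. F P Q R S * eps P' Q * eps R S')) +
        cnj (v * (1 / 2 * (\<Sum>Q<2. \<Sum>R<2. F P' Q R S' * eps P Q * eps R S)))"
        unfolding F_def
        using electric_spinor_transform[where L = L and T = T and X = Psi, OF det r T that(2,4)]
          electric_spinor_transform[where L = L and T = T and X = Psi, OF det r T that(1,3)]
        by (simp only:)
      finally show ?thesis by (simp add: sum_lessThan_2 algebra_simps)
    qed
    then show ?thesis by auto
  qed
  also have "\<dots> \<longleftrightarrow> ?r"
    using electric_components[OF totally_symmetric_scale[of F v]] totally_symmetric_transform[OF sym]
    unfolding F_def by blast
  finally show ?thesis .
qed

section \<open>Bel-Robinson superenergy against the invariant, with the equality case\<close>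

theorem theorem2:
  fixes Cw :: "nat \<Rightarrow> nat \<Rightarrow> nat \<Rightarrow> nat \<Rightarrow> real"
    and Psi :: "nat \<Rightarrow> nat \<Rightarrow> nat \<Rightarrow> nat \<Rightarrow> complex"
    and t :: "nat \<Rightarrow> real"
  assumes Psi_sym: "totally_symmetric Psi"
    and Weyl: "\<forall>a b c d. a < 4 \<longrightarrow> b < 4 \<longrightarrow> c < 4 \<longrightarrow> d < 4 \<longrightarrow>
                 Cw a b c d = weyl_of_spinor Psi a b c d"
    and unit_timelike: "(\<Sum>a<4. eta a * (t a)\<^sup>2) = 1"
  shows "cmod (invariant_I Psi) \<le> 4 * P1 Psi t \<and>
         (4 * P1 Psi t = cmod (invariant_I Psi) \<longleftrightarrow>
            (\<exists>\<theta>::real. \<forall>a<4. \<forall>d<4.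
               (\<Sum>b<4. \<Sum>c<4. duality_rotation \<theta> Cw a b c d * t b * t c) = 0))"
proof -
  obtain L :: "nat \<Rightarrow> nat \<Rightarrow> complex" and r where det: "L 0 0 * L 1 1 - L 0 1 * L 1 0 = 1" and r: "r * r = 1 / 2"
    and T: "\<And>A A'. \<lbrakk>A < 2; A' < 2\<rbrakk> \<Longrightarrow> vec_spinor t A A' = r * (\<Sum>P<2. L A P * cnj (L A' P))"
    by (rule vec_spinor_cholesky[OF unit_timelike]) blast
  define F where "F = spinor_transform L Psi"
  have F: "totally_symmetric F"
    unfolding F_def by (rule totally_symmetric_transform[OF Psi_sym])
  define N where "N = (cmod (F 0 0 0 0))\<^sup>2 + 4 * (cmod (F 0 0 0 1))\<^sup>2 + 6 * (cmod (F 0 0 1 1))\<^sup>2 +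
      4 * (cmod (F 0 1 1 1))\<^sup>2 + (cmod (F 1 1 1 1))\<^sup>2"
  have "invariant_I Psi = spinor_pairing eps F F"
    unfolding invariant_I_pairing F_def
    by (rule spinor_pairing_transform) (rule eps_transform[of L, OF det])
  then have I: "invariant_I Psi =
      2 * F 0 0 0 0 * F 1 1 1 1 - 8 * F 0 0 0 1 * F 0 1 1 1 + 6 * F 0 0 1 1 * F 0 0 1 1"
    by (simp only: pairing_components(1)[OF F])
  have P: "4 * P1 Psi t = N"
  proof -
    \<comment> \<open>In the adapted frame each of the four copies of the vector contributes
      \<open>r\<close>; the product \<open>1 / 4\<close> explains the factor 4 before
      \<open>P1\<close>.\<close>
    have "spinor_pairing (vec_spinor t) Psi (\<lambda>A B C D. cnj (Psi A B C D)) =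
      spinor_pairing (\<lambda>A B. if A = B then r else 0) F
        (spinor_transform (\<lambda>A P. cnj (L A P)) (\<lambda>A B C D. cnj (Psi A B C D)))"
      unfolding F_def
      by (rule spinor_pairing_transform) (simp add: T sum_lessThan_2 algebra_simps)
    also have "spinor_transform (\<lambda>A P. cnj (L A P)) (\<lambda>A B C D. cnj (Psi A B C D)) = (\<lambda>A B C D. cnj (F A B C D))"
      by (intro ext) (simp add: F_def spinor_transform_def)
    also have "spinor_pairing (\<lambda>A B. if A = B then r else 0) F (\<lambda>A B C D. cnj (F A B C D)) =
      (r * r) * (r * r) * complex_of_real N"
      unfolding N_def pairing_components(2)[OF F] by (simp only: mult.assoc)
    also have "\<dots> = complex_of_real (N / 4)"
      unfolding r by simp
    finally show ?thesis
      unfolding P1_pairing by (simp only: Re_complex_of_real)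
  qed
  have rot: "(\<forall>a<4. \<forall>d<4. (\<Sum>b<4. \<Sum>c<4. duality_rotation \<theta> Cw a b c d * t b * t c) = 0) \<longleftrightarrow>
      cis (- \<theta>) * F 0 0 0 0 + cnj (cis (- \<theta>) * F 1 1 1 1) = 0 \<and>
      cis (- \<theta>) * F 0 0 0 1 - cnj (cis (- \<theta>) * F 0 1 1 1) = 0 \<and>
      cis (- \<theta>) * F 0 0 1 1 + cnj (cis (- \<theta>) * F 0 0 1 1) = 0" for \<theta>
  proof -
    have "(\<Sum>b<4. \<Sum>c<4. duality_rotation \<theta> Cw a b c d * t b * t c) = 0 \<longleftrightarrow>
      Re (cis (- \<theta>) * (\<Sum>A<2. \<Sum>A'<2. \<Sum>D<2. \<Sum>D'<2.
        electric_spinor Psi (vec_spinor t) A A' D D' * sol a A A' * sol d D D')) = 0"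
      if "a < 4" "d < 4" for a d
      using rotated_electric[OF Psi_sym that, of Cw \<theta> t] Weyl
      by (simp only: mult_eq_0_iff) simp
    then show ?thesis
      unfolding F_def
      using electric_vanishing_iff[where L = L and T = "vec_spinor t" and v = "cis (- \<theta>)", OF Psi_sym det r T]
      by (simp only: cong: imp_cong)
  qed
  \<comment> \<open>Every unit complex number is \<open>cis (- \<theta>)\<close> for some angle, so
    the phases of the quartic criterion are exactly the duality rotations.\<close>
  have unit: "(\<exists>v. cmod v = 1 \<and> Q v) \<longleftrightarrow> (\<exists>\<theta>::real. Q (cis (- \<theta>)))" for Q
  proof
    assume "\<exists>v. cmod v = 1 \<and> Q v"
    then obtain v where v: "cmod v = 1" "Q v" by blast
    have "v = cis (- (- Arg v))" using rcis_cmod_Arg[of v] v(1) by (simp add: rcis_def)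
    with v(2) show "\<exists>\<theta>. Q (cis (- \<theta>))" by metis
  next
    assume "\<exists>\<theta>. Q (cis (- \<theta>))"
    then show "\<exists>v. cmod v = 1 \<and> Q v" using norm_cis by blast
  qed
  show ?thesis
    unfolding P I rot N_def
    using quartic_inequality[where ?f0.0 = "F 0 0 0 0" and ?f1.0 = "F 0 0 0 1" and ?f2.0 = "F 0 0 1 1"
        and ?f3.0 = "F 0 1 1 1" and ?f4.0 = "F 1 1 1 1"]
    by (simp only: unit)
qed

end
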